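(* Let $\mathcal{A}$ be a finite or countably infinite alphabet, let $X=\mathcal{A}^{\mathbb{Z}_-}$, and let $K\subset X$ be a nonempty subset. The following are equivalent: (i) $K$ has property $G$. (ii) $K$ has a $g$-function. (iii) $K$ has a strict $g$-function.
   Context: $\mathbb{Z}_-=\{0,-1,-2,\dots\}$. The alphabet $\mathcal{A}$ (nonempty, finite or countably infinite) carries the discrete topology, and $X=\mathcal{A}^{\mathbb{Z}_-}$, the set of all sequences $x=(\dots,x_{-1},x_0)$ with entries in $\mathcal{A}$, carries the product topology. The shift $\Theta:X\to X$ is $\Theta(x)_j=x_{j-1}$, $j\in\mathbb{Z}_-$ (it deletes the last symbol $x_0$). For $x\in X$ and $a\in\mathcal{A}$, $(x,a)\in X$ denotes the sequence $(\dots,x_{-1},x_0,a)$; thus $\Theta^{-1}(x)=\{(x,a):a\in\mathcal{A}\}$. $\mathcal{G}$ is the set of all continuous functions $g:X\to[0,1]$ such that $\sum_{x'\in\Theta^{-1}(x)}g(x')=1$ for every $x\in X$. For a nonempty subset $K\subset X$, $K^c$ is the complement, overline denotes closure in $X$, and $K_e=\{x\in K^c:\Theta(x)\in K\}$ is the set of points of exit from $K$. $K$ is invariant for $g\in\mathcal{G}$ if $g(x)=0$ for all $x\in K_e$. $K$ has property $G$ if there is no $x\in X$ with $(x,a)\in\overline{K_e}$ for every $a\in\mathcal{A}$. $K$ has a $g$-function if $K$ is invariant for some $g\in\mathcal{G}$. $K$ has a strict $g$-function if $K$ is invariant for some $g\in\mathcal{G}$ with $\{x\in X: g(x)=0\}=\overline{K_e}$.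 *)

theory Defs
  imports "HOL-Analysis.Analysis"
begin

text \<open>
  A point \<open>x = (\<dots>, x\<^sub>-\<^sub>1, x\<^sub>0)\<close> is encoded by reversing the sign of the index: \<open>x n\<close> is the entry at
  position \<open>-n\<close>. The type \<open>nat \<Rightarrow> 'a\<close> carries the product topology.
\<close>

type_synonym 'a past = "nat \<Rightarrow> 'a"

definition shift :: "'a past \<Rightarrow> 'a past" where
  "shift x = (\<lambda>n. x (Suc n))"

definition append_symbol :: "'a past \<Rightarrow> 'a \<Rightarrow> 'a past" where
  "append_symbol x a = (\<lambda>n. case n of 0 \<Rightarrow> a | Suc m \<Rightarrow> x m)"

lemma shift_vimage: "shift -` {x} = range (append_symbol x)"
proof -
  have "y = append_symbol (shift y) (y 0)" for y :: "'a past"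
    by (auto simp: shift_def append_symbol_def fun_eq_iff split: nat.split)
  moreover have "shift (append_symbol x a) = x" for a
    by (simp add: shift_def append_symbol_def)
  ultimately show ?thesis
    by (auto intro: range_eqI)
qed

definition g_functions :: "('a::topological_space past \<Rightarrow> real) set" where
  "g_functions = {g. continuous_on UNIV g \<and> range g \<subseteq> {0..1} \<and>
     (\<forall>x. (g has_sum 1) (shift -` {x}))}"

definition exit_points :: "'a past set \<Rightarrow> 'a past set" where
  "exit_points K = {x \<in> - K. shift x \<in> K}"

definition invariant_for :: "'a past set \<Rightarrow> ('a past \<Rightarrow> real) \<Rightarrow> bool" where
  "invariant_for K g \<longleftrightarrow> (\<forall>x\<in>exit_points K. g x = 0)"

definition property_G :: "'a::topological_space past set \<Rightarrow> bool" where
  "property_G K \<longleftrightarrow> (\<nexists>x. \<forall>a. append_symbol x a \<in> closure (exit_points K))"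

definition has_g_function :: "'a::topological_space past set \<Rightarrow> bool" where
  "has_g_function K \<longleftrightarrow> (\<exists>g\<in>g_functions. invariant_for K g)"

definition has_strict_g_function :: "'a::topological_space past set \<Rightarrow> bool" where
  "has_strict_g_function K \<longleftrightarrow>
     (\<exists>g\<in>g_functions. invariant_for K g \<and> {x. g x = 0} = closure (exit_points K))"

end

theory Submission imports Defs begin

text \<open>
  A continuous function has a closed zero set, so a \<open>g\<close>-function for \<open>K\<close> vanishes not only on the
  exit points but on their closure \<open>C\<close>. If all one-symbol extensions of some past \<open>x\<close> lay in \<open>C\<close>,
  the values of \<open>g\<close> over the fibre of \<open>x\<close> would add up to \<open>0\<close> instead of \<open>1\<close>; this is the easy
  direction.

  Conversely, every closed set \<open>C\<close> of pasts is the zero set of a continuous function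
  \<open>f \<ge> 0\<close> (\<open>depth_gap\<close> below, a discrete form of the distance to \<open>C\<close>). Property \<open>G\<close> says that
  \<open>f\<close> does not vanish identically on any fibre of the shift, so \<open>f\<close> can be normalized fibrewise.
  As fibres may be infinite, the symbols first receive summable positive weights \<open>w\<close>:
  \[ g(x) = \frac{w(x_0) f(x)}{\sum_a w(a) f(\Theta(x), a)}. \]
  The denominator is positive, and it is continuous because the weights make the series
  converge uniformly (\<open>continuous_on_weighted_sum\<close>). Normalizing preserves the zero set, so the
  \<open>g\<close>-function so obtained is strict.
\<close>

section \<open>Weighted sums over a countable type\<close>

definition weight :: "'i::countable \<Rightarrow> real" where
  "weight i = (1/2) ^ to_nat i"

definition weighted_sum :: "('i::countable \<Rightarrow> real) \<Rightarrow> real" where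
  "weighted_sum f = (\<Sum>\<^sub>\<infinity>i. weight i * f i)"

lemma weight_pos [simp]: "weight i > 0"
  by (simp add: weight_def)

lemma weight_nonneg [simp]: "weight i \<ge> 0"
  by (simp add: weight_def)

lemma weight_nonzero [simp]: "weight i \<noteq> 0"
  by (simp add: weight_def)

lemma weight_summable: "(weight :: 'i::countable \<Rightarrow> real) summable_on UNIV"
proof -
  have "(\<lambda>n. (1/2::real) ^ n) summable_on UNIV"
    by (rule norm_summable_imp_summable_on) (simp add: summable_geometric)
  then have "(\<lambda>n. (1/2::real) ^ n) summable_on range (to_nat :: 'i \<Rightarrow> nat)"
    by (rule summable_on_subset_banach) simp
  then show ?thesis
    by (simp add: summable_on_reindex weight_def[abs_def] o_def)
qed

lemma weighted_sum_summable:
  assumes "\<And>i. 0 \<le> f i" "\<And>i. f i \<le> B"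
  shows "(\<lambda>i. weight i * f i) summable_on UNIV"
proof (rule summable_on_comparison_test)
  show "(\<lambda>i. weight i * B) summable_on UNIV"
    by (intro summable_on_cmult_left weight_summable)
qed (use assms in \<open>auto intro!: mult_left_mono\<close>)

lemma weighted_sum_has_sum:
  assumes "\<And>i. 0 \<le> f i" "\<And>i. f i \<le> B"
  shows "((\<lambda>i. weight i * f i) has_sum weighted_sum f) UNIV"
  unfolding weighted_sum_def using weighted_sum_summable[OF assms] by (rule has_sum_infsum)

lemma weighted_sum_nonneg:
  assumes "\<And>i. 0 \<le> f i"
  shows "0 \<le> weighted_sum f"
  unfolding weighted_sum_def
  by (intro infsum_nonneg mult_nonneg_nonneg assms weight_nonneg)

lemma weighted_sum_ge_term:
  assumes "\<And>i. 0 \<le> f i" "\<And>i. f i \<le> B"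
  shows "weight i * f i \<le> weighted_sum f"
  using finite_sum_le_infsum[OF weighted_sum_summable[OF assms], of "{i}"] assms(1)
  by (simp add: weighted_sum_def)

lemma weighted_sum_le:
  fixes f :: "'i::countable \<Rightarrow> real"
  assumes "\<And>i. 0 \<le> f i" "\<And>i. f i \<le> B"
  shows "weighted_sum f \<le> weighted_sum (\<lambda>_::'i. B)"
  unfolding weighted_sum_def
proof (rule infsum_mono)
  show "(\<lambda>i. weight i * f i) summable_on UNIV"
    using assms by (rule weighted_sum_summable)
  show "(\<lambda>i::'i. weight i * B) summable_on UNIV"
    by (intro summable_on_cmult_left weight_summable)
qed (use assms in \<open>auto intro!: mult_left_mono\<close>)

lemma weighted_sum_eq_0_iff:
  assumes "\<And>i. 0 \<le> f i" "\<And>i. f i \<le> B"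
  shows "weighted_sum f = 0 \<longleftrightarrow> (\<forall>i. f i = 0)"
proof
  assume "weighted_sum f = 0"
  then show "\<forall>i. f i = 0"
    using weighted_sum_ge_term[of f, OF assms] assms(1)
    by (metis antisym mult_le_0_iff not_le weight_pos)
qed (simp add: weighted_sum_def)

text \<open>
  By the Weierstrass test with the majorant \<open>weight i * B\<close>, the finite partial sums converge
  uniformly.
\<close>

lemma continuous_on_weighted_sum:
  fixes f :: "'i::countable \<Rightarrow> 'x::topological_space \<Rightarrow> real"
  assumes cont: "\<And>i. continuous_on S (f i)"
    and bounds: "\<And>i x. 0 \<le> f i x" "\<And>i x. f i x \<le> B"
  shows "continuous_on S (\<lambda>x. weighted_sum (\<lambda>i. f i x))"
  unfolding weighted_sum_def
proof (rule uniform_limit_theorem)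
  show "uniform_limit S (\<lambda>I x. \<Sum>i\<in>I. weight i * f i x)
          (\<lambda>x. \<Sum>\<^sub>\<infinity>i. weight i * f i x) (finite_subsets_at_top UNIV)"
  proof (rule Weierstrass_m_test_general)
    show "(\<lambda>i::'i. weight i * B) summable_on UNIV"
      by (intro summable_on_cmult_left weight_summable)
  qed (use bounds in \<open>auto intro!: mult_left_mono simp: abs_mult\<close>)
qed (auto intro!: always_eventually continuous_intros cont)

section \<open>Closed sets of pasts as zero sets\<close>

lemma open_cylinder:
  fixes x :: "'a::discrete_topology past"
  shows "open {y. \<forall>i<n. y i = x i}"
proof -
  have "open ((\<lambda>y :: 'a past. y i) -` {x i})" for i
    by (intro open_vimage open_discrete continuous_on_product_coordinates)
  then have "open (\<Inter>i<n. (\<lambda>y. y i) -` {x i})"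
    by (intro open_INT) auto
  moreover have "(\<Inter>i<n. (\<lambda>y. y i) -` {x i}) = {y. \<forall>i<n. y i = x i}"
    by auto
  ultimately show ?thesis
    by simp
qed

lemma continuous_on_finitely_determined:
  fixes F :: "'a::discrete_topology past \<Rightarrow> 'b::topological_space"
  assumes "\<And>x y. (\<And>i. i < n \<Longrightarrow> y i = x i) \<Longrightarrow> F y = F x"
  shows "continuous_on UNIV F"
proof -
  have "open (F -` U)" for U
  proof (rule Topological_Spaces.openI)
    fix x assume x: "x \<in> F -` U"
    have "{y. \<forall>i<n. y i = x i} \<subseteq> F -` U"
    proof
      fix y assume "y \<in> {y. \<forall>i<n. y i = x i}"
      then have "F y = F x"
        by (intro assms) simp
      then show "y \<in> F -` U"
        using x by simp
    qed
    then show "\<exists>T. open T \<and> x \<in> T \<and> T \<subseteq> F -` U"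
      by (intro exI[of _ "{y. \<forall>i<n. y i = x i}"]) (simp add: open_cylinder)
  qed
  then show ?thesis
    by (simp add: continuous_on_open_vimage)
qed

lemma open_contains_cylinder:
  fixes x :: "'a::topological_space past"
  assumes "open U" "x \<in> U"
  obtains n where "{y. \<forall>i<n. y i = x i} \<subseteq> U"
proof -
  have "openin (product_topology (\<lambda>i. euclidean) UNIV) U"
    using assms(1) by (simp add: open_fun_def)
  from product_topology_open_contains_basis[OF this assms(2)] obtain X
    where X: "x \<in> Pi\<^sub>E UNIV X" "finite {i. X i \<noteq> UNIV}" "Pi\<^sub>E UNIV X \<subseteq> U"
    by auto
  obtain n where n: "i < n" if "X i \<noteq> UNIV" for i
    using X(2) unfolding finite_nat_set_iff_bounded by auto
  have "{y. \<forall>i<n. y i = x i} \<subseteq> Pi\<^sub>E UNIV X"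
  proof (clarsimp simp: PiE_iff)
    fix y i assume "\<forall>i<n. y i = x i"
    then show "y i \<in> X i"
      using n[of i] X(1) by (cases "X i = UNIV") (auto simp: PiE_iff)
  qed
  then show ?thesis
    using X(3) by (intro that) (rule subset_trans)
qed

text \<open>
  The depths \<open>n\<close> at which the cylinder around \<open>x\<close> has separated from \<open>C\<close>, counted with weights.
  Unlike a distance to \<open>C\<close>, this needs no case distinction for \<open>C = {}\<close>, where it is positive
  everywhere.
\<close>

definition depth_gap :: "'a past set \<Rightarrow> 'a past \<Rightarrow> real" where
  "depth_gap C x = weighted_sum (\<lambda>n. of_bool (\<forall>y\<in>C. \<exists>i<n. y i \<noteq> x i))"

lemma depth_gap_nonneg: "0 \<le> depth_gap C x"
  unfolding depth_gap_def by (rule weighted_sum_nonneg) simp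

lemma depth_gap_le: "depth_gap C x \<le> weighted_sum (\<lambda>_::nat. 1)"
  unfolding depth_gap_def by (rule weighted_sum_le) auto

text \<open>Whether \<open>x\<close> has separated from \<open>C\<close> at depth \<open>n\<close> depends on the first \<open>n\<close> entries of \<open>x\<close> only.\<close>

lemma continuous_on_depth_gap:
  "continuous_on UNIV (depth_gap C :: 'a::discrete_topology past \<Rightarrow> real)"
  unfolding depth_gap_def
proof (rule continuous_on_weighted_sum)
  show "continuous_on UNIV
      (\<lambda>x :: 'a past. of_bool (\<forall>y\<in>C. \<exists>i<n. y i \<noteq> x i) :: real)" for n
  proof (rule continuous_on_finitely_determined)
    fix x z :: "'a past" assume eq: "\<And>i. i < n \<Longrightarrow> z i = x i"
    have "(\<exists>i<n. y i \<noteq> z i) \<longleftrightarrow> (\<exists>i<n. y i \<noteq> x i)" for y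
      using eq by auto
    then show "of_bool (\<forall>y\<in>C. \<exists>i<n. y i \<noteq> z i) = (of_bool (\<forall>y\<in>C. \<exists>i<n. y i \<noteq> x i) :: real)"
      by simp
  qed
  show "of_bool P \<le> (1::real)" for P
    by simp
qed simp

text \<open>
  The gap vanishes when every cylinder around \<open>x\<close> meets \<open>C\<close>; as the cylinders form a neighbourhood
  base at \<open>x\<close>, this means that \<open>x\<close> lies in the closure of \<open>C\<close>.
\<close>

lemma depth_gap_eq_0_iff:
  fixes C :: "'a::topological_space past set"
  assumes "closed C"
  shows "depth_gap C x = 0 \<longleftrightarrow> x \<in> C"
proof -
  have "depth_gap C x = 0 \<longleftrightarrow> (\<forall>n. \<exists>y\<in>C. \<forall>i<n. y i = x i)"
    unfolding depth_gap_def by (subst weighted_sum_eq_0_iff[where B = 1]) auto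
  also have "\<dots> \<longleftrightarrow> x \<in> C"
  proof
    assume *: "\<forall>n. \<exists>y\<in>C. \<forall>i<n. y i = x i"
    show "x \<in> C"
    proof (rule ccontr)
      assume "x \<notin> C"
      then obtain n where "{y. \<forall>i<n. y i = x i} \<subseteq> - C"
        using open_contains_cylinder[of "- C" x] assms by auto
      with * show False
        by blast
    qed
  qed auto
  finally show ?thesis .
qed

section \<open>Fibres of the shift\<close>

lemma shift_append_symbol [simp]: "shift (append_symbol x a) = x"
  by (simp add: shift_def append_symbol_def)

lemma append_symbol_0 [simp]: "append_symbol x a 0 = a"
  by (simp add: append_symbol_def)

lemma append_symbol_shift: "append_symbol (shift x) (x 0) = x"
  by (auto simp: shift_def append_symbol_def fun_eq_iff split: nat.split)

lemma has_sum_shift_fibre: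
  "(g has_sum s) (shift -` {x}) \<longleftrightarrow> ((\<lambda>a. g (append_symbol x a)) has_sum s) UNIV"
proof -
  have "inj (append_symbol x)"
    by (rule injI) (metis append_symbol_0)
  then show ?thesis
    by (simp add: shift_vimage has_sum_reindex o_def)
qed

lemma continuous_on_shift: "continuous_on UNIV (shift :: 'a::topological_space past \<Rightarrow> 'a past)"
  unfolding shift_def by (intro continuous_intros continuous_on_product_coordinates)

lemma continuous_on_append_symbol:
  "continuous_on UNIV (\<lambda>x :: 'a::topological_space past. append_symbol x a)"
  unfolding append_symbol_def
proof (rule continuous_on_coordinatewise_then_product)
  show "continuous_on UNIV (\<lambda>x. case n of 0 \<Rightarrow> a | Suc m \<Rightarrow> x m)" for n
    by (cases n) auto
qed

text \<open>
  Fibrewise normalization. A point of the fibre at which \<open>f\<close> is positive makes the denominator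
  positive, and the bound \<open>B\<close> makes it a uniformly convergent series, hence continuous. The
  denominator depends on \<open>x\<close> only through \<open>shift x\<close>, so it is constant on each fibre.
\<close>

lemma g_function_of_zero_set:
  fixes f :: "'a::{countable, discrete_topology} past \<Rightarrow> real"
  assumes cont: "continuous_on UNIV f"
    and bounds: "\<And>x. 0 \<le> f x" "\<And>x. f x \<le> B"
    and fibre: "\<And>x. \<exists>a. f (append_symbol x a) \<noteq> 0"
  obtains g where "g \<in> g_functions" "{x. g x = 0} = {x. f x = 0}"
proof -
  define total where "total x = weighted_sum (\<lambda>a. f (append_symbol x a))" for x
  define g where "g x = weight (x 0) * f x / total (shift x)" for x
  have total_pos: "total x > 0" for x
    using weighted_sum_nonneg[of "\<lambda>a. f (append_symbol x a)"]
      weighted_sum_eq_0_iff[of "\<lambda>a. f (append_symbol x a)" B] bounds fibre[of x]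
    unfolding total_def by force
  have cont_total: "continuous_on UNIV total"
    unfolding total_def
    by (rule continuous_on_weighted_sum[where B = B])
      (use bounds continuous_on_compose2[OF cont continuous_on_append_symbol] in auto)
  have "continuous_on UNIV (\<lambda>x :: 'a past. weight (x 0))"
    by (rule continuous_on_finitely_determined[of 1]) simp
  then have "continuous_on UNIV g"
    unfolding g_def using total_pos
    by (intro continuous_intros cont continuous_on_compose2[OF cont_total continuous_on_shift])
      (auto simp: less_imp_neq[symmetric])
  moreover have "g x \<in> {0..1}" for x
  proof -
    \<comment> \<open>The numerator is one of the nonnegative terms of the series in the denominator.\<close>
    have "weight (x 0) * f x \<le> total (shift x)"
      using weighted_sum_ge_term[of "\<lambda>a. f (append_symbol (shift x) a)" B "x 0"] bounds
      by (simp add: total_def append_symbol_shift)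
    then show ?thesis
      using total_pos[of "shift x"] bounds by (simp add: g_def)
  qed
  moreover have "(g has_sum 1) (shift -` {x})" for x
  proof -
    have "((\<lambda>a. weight a * f (append_symbol x a)) has_sum total x) UNIV"
      unfolding total_def by (rule weighted_sum_has_sum[where B = B]) (use bounds in auto)
    from has_sum_divide_const[OF this, of "total x"] show ?thesis
      using total_pos[of x] by (simp add: has_sum_shift_fibre g_def)
  qed
  ultimately have "g \<in> g_functions"
    by (auto simp: g_functions_def)
  moreover have "g x = 0 \<longleftrightarrow> f x = 0" for x
    using total_pos[of "shift x"] by (simp add: g_def)
  ultimately show ?thesis
    using that by simp
qed

section \<open>The characterization of property G\<close>

lemma has_g_function_imp_property_G:
  assumes "has_g_function K"
  shows "property_G K"
  unfolding property_G_def
proof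
  obtain g where g: "g \<in> g_functions" "invariant_for K g"
    using assms by (auto simp: has_g_function_def)
  have "closed {x. g x = 0}"
    using g(1) by (intro closed_Collect_eq) (auto simp: g_functions_def)
  then have zero: "closure (exit_points K) \<subseteq> {x. g x = 0}"
    using g(2) by (intro closure_minimal) (auto simp: invariant_for_def)
  assume "\<exists>x. \<forall>a. append_symbol x a \<in> closure (exit_points K)"
  then obtain x where "\<And>a. g (append_symbol x a) = 0"
    using zero by blast
  moreover have "((\<lambda>a. g (append_symbol x a)) has_sum 1) UNIV"
    using g(1) by (simp add: g_functions_def flip: has_sum_shift_fibre)
  ultimately show False
    using has_sum_unique[OF has_sum_0_simp, of UNIV "1::real"] by simp
qed

lemma property_G_imp_has_strict_g_function:
  fixes K :: "'a::{countable, discrete_topology} past set"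
  assumes "property_G K"
  shows "has_strict_g_function K"
proof -
  let ?C = "closure (exit_points K)"
  have zero: "depth_gap ?C x = 0 \<longleftrightarrow> x \<in> ?C" for x
    by (simp add: depth_gap_eq_0_iff)
  have "\<exists>a. depth_gap ?C (append_symbol x a) \<noteq> 0" for x
    using assms by (simp add: zero property_G_def)
  then obtain g where "g \<in> g_functions" "{x. g x = 0} = {x. depth_gap ?C x = 0}"
    by (rule g_function_of_zero_set[OF continuous_on_depth_gap depth_gap_nonneg depth_gap_le])
  moreover from this(2) have g_zero: "{x. g x = 0} = ?C"
    by (simp add: zero)
  moreover have "invariant_for K g"
    using g_zero closure_subset[of "exit_points K"] by (auto simp: invariant_for_def)
  ultimately show ?thesis
    by (auto simp: has_strict_g_function_def)
qed

theorem theorem1: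
  fixes K :: "'a::{countable, discrete_topology} past set"
  assumes "K \<noteq> {}"
  shows "(property_G K \<longleftrightarrow> has_g_function K) \<and>
         (has_g_function K \<longleftrightarrow> has_strict_g_function K)"
proof -
  have "has_strict_g_function K \<Longrightarrow> has_g_function K"
    by (auto simp: has_strict_g_function_def has_g_function_def)
  then show ?thesis
    using has_g_function_imp_property_G property_G_imp_has_strict_g_function by blast
qed

end
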